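(* Let $Z=QUWX_1X_2X_sY_pY_s\in\mathcal{P}^*$ and let $\mathcal{R}^o(Z)$ be the set of all pairs $(R_s,R_p)$ of the form $R_s=S+T$, $R_p=R_1+R_2$ with $(R_1,R_2,S,T)\in\delta^o(Z)$. Then $\mathcal{R}^o(Z)$ consists exactly of all pairs $(R_s,R_p)$ of nonnegative reals satisfying $$R_p\le\rho_p^o,\qquad R_s\le\rho_s^o,\qquad R_s+R_p\le\rho_{sp}^o,$$ where $$\rho_p^o=I(Y_p;X_1X_2|WQ),\qquad \rho_s^o=I(Y_s;U|WQ)+\sigma^*,$$ $$\rho_{sp}^o=\rho_p^o+I(Y_s;U|WQ)+\min\{I(Y_s;W|Q),\,I(Y_p;W|Q)\},$$ $$\sigma^*=\min\{I(Y_p;W|X_1X_2Q),\,I(Y_s;W|Q)\}.$$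
   Context: $\mathcal{X}_1,\mathcal{X}_2,\mathcal{X}_s,\mathcal{Y}_p,\mathcal{Y}_s$ are finite sets and $\omega(y_py_s|x_1x_2x_s)$ is a channel (conditional probability distribution) from $\mathcal{X}_1\times\mathcal{X}_2\times\mathcal{X}_s$ to $\mathcal{Y}_p\times\mathcal{Y}_s$. $\mathcal{P}^*$ is the set of all tuples of random variables $Z=QUWX_1X_2X_sY_pY_s$, with $Q,U,W$ taking values in some finite sets and $X_a\in\mathcal{X}_a$, $Y_b\in\mathcal{Y}_b$, such that: $X_1,X_2,U,W$ are conditionally independent given $Q$; $X_s=f(UW|Q)$, i.e. $X_s$ is a deterministic function of $(U,W)$ for each value of $Q$; and given $(Q,U,W,X_1,X_2,X_s)$ the pair $(Y_p,Y_s)$ has conditional law $\omega(\cdot|X_1X_2X_s)$. $\delta^o(Z)$ is the set of all tuples $(R_1,R_2,S,T)$ of nonnegative reals satisfying $$R_1\le I(Y_p;X_1|WX_2Q),\quad R_2\le I(Y_p;X_2|WX_1Q),\quad T\le I(Y_p;W|X_1X_2Q),$$ $$R_1+R_2\le I(Y_p;X_1X_2|WQ),\quad T+R_1\le I(Y_p;WX_1|X_2Q),\quad T+R_2\le I(Y_p;WX_2|X_1Q),$$ $$T+R_1+R_2\le I(Y_p;WX_1X_2|Q),$$ $$S\le I(Y_s;U|WQ),\quad T\le I(Y_s;W|UQ),\quad S+T\le I(Y_s;UW|Q).$$ *)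

theory Defs
  imports "HOL-Probability.Probability"
begin

text \<open>
  The finite alphabets of the channel are finite types; a channel is a map from input
  letters to probability mass functions on pairs of output letters.
\<close>

type_synonym ('x1, 'x2, 'xs, 'yp, 'ys) channel =
  "'x1 \<times> 'x2 \<times> 'xs \<Rightarrow> ('yp \<times> 'ys) pmf"

type_synonym ('m, 'q, 'u, 'w, 'x1, 'x2, 'xs, 'yp, 'ys) rv_tuple =
  "('m \<Rightarrow> 'q) \<times> ('m \<Rightarrow> 'u) \<times> ('m \<Rightarrow> 'w) \<times> ('m \<Rightarrow> 'x1) \<times> ('m \<Rightarrow> 'x2)
     \<times> ('m \<Rightarrow> 'xs) \<times> ('m \<Rightarrow> 'yp) \<times> ('m \<Rightarrow> 'ys)"

text \<open>
  The admissible tuples of random variables on the probability space \<open>M\<close>. The auxiliary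
  variables \<open>Q\<close>, \<open>U\<close>, \<open>W\<close> range over arbitrary types; \<^const>\<open>simple_function\<close> says that each
  variable is measurable and takes only finitely many values. The independence condition
  needs no guard: if \<open>Q = q\<close> has probability zero, \<^const>\<open>cond_prob\<close> makes both sides zero.
\<close>

definition Pstar ::
  "'m measure \<Rightarrow> ('x1::finite, 'x2::finite, 'xs::finite, 'yp::finite, 'ys::finite) channel
    \<Rightarrow> ('m, 'q, 'u, 'w, 'x1, 'x2, 'xs, 'yp, 'ys) rv_tuple set" where
  "Pstar M \<omega> = {(Q, U, W, X1, X2, Xs, Yp, Ys).
     simple_function M Q \<and> simple_function M U \<and> simple_function M W \<and>
     simple_function M X1 \<and> simple_function M X2 \<and> simple_function M Xs \<and>
     simple_function M Yp \<and> simple_function M Ys \<and>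
     (\<forall>q x1 x2 u w.
        \<P>(z in M. X1 z = x1 \<and> X2 z = x2 \<and> U z = u \<and> W z = w \<bar> Q z = q) =
        \<P>(z in M. X1 z = x1 \<bar> Q z = q) * \<P>(z in M. X2 z = x2 \<bar> Q z = q) *
        \<P>(z in M. U z = u \<bar> Q z = q) * \<P>(z in M. W z = w \<bar> Q z = q)) \<and>
     (\<exists>f. AE z in M. Xs z = f (Q z) (U z) (W z)) \<and>
     (\<forall>q u w x1 x2 xs.
        \<P>(z in M. Q z = q \<and> U z = u \<and> W z = w \<and> X1 z = x1 \<and> X2 z = x2 \<and> Xs z = xs) > 0 \<longrightarrow>
        (\<forall>yp ys.
           \<P>(z in M. Yp z = yp \<and> Ys z = ys \<bar>
               Q z = q \<and> U z = u \<and> W z = w \<and> X1 z = x1 \<and> X2 z = x2 \<and> Xs z = xs) =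
           pmf (\<omega> (x1, x2, xs)) (yp, ys)))}"

context information_space
begin

fun delta_o ::
  "('a, 'q, 'u, 'w, 'x1, 'x2, 'xs, 'yp, 'ys) rv_tuple \<Rightarrow> (real \<times> real \<times> real \<times> real) set"
where
  "delta_o (Q, U, W, X1, X2, Xs, Yp, Ys) = {(R1, R2, S, T).
     0 \<le> R1 \<and> 0 \<le> R2 \<and> 0 \<le> S \<and> 0 \<le> T \<and>
     R1 \<le> \<I>(Yp ; X1 | (\<lambda>z. (W z, X2 z, Q z))) \<and>
     R2 \<le> \<I>(Yp ; X2 | (\<lambda>z. (W z, X1 z, Q z))) \<and>
     T \<le> \<I>(Yp ; W | (\<lambda>z. (X1 z, X2 z, Q z))) \<and>
     R1 + R2 \<le> \<I>(Yp ; (\<lambda>z. (X1 z, X2 z)) | (\<lambda>z. (W z, Q z))) \<and>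
     T + R1 \<le> \<I>(Yp ; (\<lambda>z. (W z, X1 z)) | (\<lambda>z. (X2 z, Q z))) \<and>
     T + R2 \<le> \<I>(Yp ; (\<lambda>z. (W z, X2 z)) | (\<lambda>z. (X1 z, Q z))) \<and>
     T + R1 + R2 \<le> \<I>(Yp ; (\<lambda>z. (W z, X1 z, X2 z)) | Q) \<and>
     S \<le> \<I>(Ys ; U | (\<lambda>z. (W z, Q z))) \<and>
     T \<le> \<I>(Ys ; W | (\<lambda>z. (U z, Q z))) \<and>
     S + T \<le> \<I>(Ys ; (\<lambda>z. (U z, W z)) | Q)}"

definition rate_region_o ::
  "('a, 'q, 'u, 'w, 'x1, 'x2, 'xs, 'yp, 'ys) rv_tuple \<Rightarrow> (real \<times> real) set"
where
  "rate_region_o Z = {(S + T, R1 + R2) |R1 R2 S T. (R1, R2, S, T) \<in> delta_o Z}"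

fun sigma_star :: "('a, 'q, 'u, 'w, 'x1, 'x2, 'xs, 'yp, 'ys) rv_tuple \<Rightarrow> real" where
  "sigma_star (Q, U, W, X1, X2, Xs, Yp, Ys) =
     min (\<I>(Yp ; W | (\<lambda>z. (X1 z, X2 z, Q z)))) (\<I>(Ys ; W | Q))"

fun rho_p :: "('a, 'q, 'u, 'w, 'x1, 'x2, 'xs, 'yp, 'ys) rv_tuple \<Rightarrow> real" where
  "rho_p (Q, U, W, X1, X2, Xs, Yp, Ys) = \<I>(Yp ; (\<lambda>z. (X1 z, X2 z)) | (\<lambda>z. (W z, Q z)))"

fun rho_s :: "('a, 'q, 'u, 'w, 'x1, 'x2, 'xs, 'yp, 'ys) rv_tuple \<Rightarrow> real" where
  "rho_s (Q, U, W, X1, X2, Xs, Yp, Ys) =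
     \<I>(Ys ; U | (\<lambda>z. (W z, Q z))) + sigma_star (Q, U, W, X1, X2, Xs, Yp, Ys)"

fun rho_sp :: "('a, 'q, 'u, 'w, 'x1, 'x2, 'xs, 'yp, 'ys) rv_tuple \<Rightarrow> real" where
  "rho_sp (Q, U, W, X1, X2, Xs, Yp, Ys) =
     rho_p (Q, U, W, X1, X2, Xs, Yp, Ys) + \<I>(Ys ; U | (\<lambda>z. (W z, Q z)))
       + min (\<I>(Ys ; W | Q)) (\<I>(Yp ; W | Q))"

end

end

theory Submission
  imports Defs
begin

text \<open>
  Write \<open>f A\<close> for the bound on the rates in \<open>A \<subseteq> {W, X1, X2}\<close> that the primary
  receiver imposes, \<open>f A = I(Yp; A | A\<^sup>c Q)\<close>. Conditional independence of the inputs makes \<open>f\<close>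
  submodular, so a total rate \<open>Rp\<close> can be split into \<open>R1 + R2\<close> next to a given \<open>T\<close> as soon as
  \<open>T \<le> f {W}\<close>, \<open>Rp \<le> f {X1, X2}\<close> and \<open>T + Rp \<le> f {W, X1, X2}\<close>. Given \<open>(Rs, Rp)\<close>, spend as much
  of \<open>Rs\<close> as possible on \<open>S\<close>, i.e. \<open>S = min Rs I(Ys; U | W Q)\<close>: then either \<open>T = 0\<close>, or
  \<open>S\<close> is extremal and the three bounds on \<open>(Rs, Rp)\<close> turn into exactly these conditions.
\<close>

section \<open>Conditional mutual information of simple functions\<close>

context information_space
begin

lemma prob_simple_function_compose:
  assumes X: "simple_function M X"
  shows "\<P>(z in M. g (X z) = s) = (\<Sum>x\<in>{x \<in> X ` space M. g x = s}. \<P>(z in M. X z = x))"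
proof -
  have "{z \<in> space M. g (X z) = s}
      = (\<Union>x\<in>{x \<in> X ` space M. g x = s}. {z \<in> space M. X z = x})"
    by auto
  moreover have "{z \<in> space M. X z = x} \<in> events" for x
    using simple_functionD(2)[OF X, of "{x}"] by (simp add: vimage_def Int_def conj_commute)
  ultimately show ?thesis
    using simple_functionD(1)[OF X]
    by (subst finite_measure_finite_Union[symmetric]) (auto simp: disjoint_family_on_def)
qed

text \<open>Grouping by the fibres of \<open>g\<close> indexes the entropy by the range of
  \<open>X\<close> itself, so entropies of different marginals of one tuple can be combined term by
  term.\<close>

lemma entropy_simple_function_compose:
  assumes X: "simple_function M X"
  shows "\<H>(\<lambda>z. g (X z)) =
    - (\<Sum>x\<in>X ` space M. \<P>(z in M. X z = x) * log b \<P>(z in M. g (X z) = g x))"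
proof -
  have gX: "simple_function M (\<lambda>z. g (X z))"
    using simple_function_compose[OF X, of g] by (simp add: comp_def)
  have vimage: "(\<lambda>z. g (X z)) -` {s} \<inter> space M = {z \<in> space M. g (X z) = s}" for s
    by auto
  have "\<H>(\<lambda>z. g (X z)) = - (\<Sum>s\<in>(\<lambda>z. g (X z)) ` space M.
      \<P>(z in M. g (X z) = s) * log b \<P>(z in M. g (X z) = s))"
    using entropy_simple_distributed[OF simple_distributedI[OF gX measure_nonneg refl]]
    by (simp add: vimage)
  also have "\<dots> = - (\<Sum>s\<in>g ` X ` space M. \<Sum>x\<in>{x \<in> X ` space M. g x = s}.
      \<P>(z in M. X z = x) * log b \<P>(z in M. g (X z) = g x))"
    by (simp add: prob_simple_function_compose[OF X] sum_distrib_right image_image)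
  also have "\<dots> = - (\<Sum>x\<in>X ` space M. \<P>(z in M. X z = x) * log b \<P>(z in M. g (X z) = g x))"
    using simple_functionD(1)[OF X] by (subst sum.image_gen[symmetric]) auto
  finally show ?thesis .
qed

text \<open>\<open>X\<close> and \<open>Y\<close> induce the same partition, so \<open>Y\<close> is
  an injective relabelling of \<open>X\<close>. This absorbs reordering and regrouping of tuple
  components.\<close>

lemma entropy_cong:
  assumes X: "simple_function M X" and Y: "simple_function M Y"
    and eq: "\<And>z z'. X z = X z' \<longleftrightarrow> Y z = Y z'"
  shows "\<H>(X) = \<H>(Y)"
proof -
  define g where "g x = Y (SOME z. X z = x)" for x
  have g: "g (X z) = Y z" for z
    unfolding g_def using eq someI[of "\<lambda>z'. X z' = X z" z] by auto
  then have "inj_on g (X ` space M)" "g \<circ> X = Y"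
    using eq by (auto simp: inj_on_def)
  then show ?thesis
    using entropy_of_inj[OF X, of g] by simp
qed

lemma conditional_mutual_information_eq_sum:
  assumes X: "simple_function M X" and Y: "simple_function M Y" and Z: "simple_function M Z"
  shows "\<I>(X ; Y | Z) = (\<Sum>(x, y, z)\<in>(\<lambda>t. (X t, Y t, Z t)) ` space M.
      \<P>(t in M. X t = x \<and> Y t = y \<and> Z t = z) *
      log b (\<P>(t in M. X t = x \<and> Y t = y \<and> Z t = z) /
        (\<P>(t in M. X t = x \<and> Z t = z) * (\<P>(t in M. Y t = y \<and> Z t = z) / \<P>(t in M. Z t = z)))))"
proof -
  note sd = simple_distributedI[OF _ measure_nonneg refl]
  note sp = simple_function_Pair
  have "Z -` {z} \<inter> space M = {t \<in> space M. Z t = z}"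
    "(\<lambda>t. (Y t, Z t)) -` {(y, z)} \<inter> space M = {t \<in> space M. Y t = y \<and> Z t = z}"
    "(\<lambda>t. (X t, Z t)) -` {(x, z)} \<inter> space M = {t \<in> space M. X t = x \<and> Z t = z}"
    "(\<lambda>t. (X t, Y t, Z t)) -` {(x, y, z)} \<inter> space M
       = {t \<in> space M. X t = x \<and> Y t = y \<and> Z t = z}" for x y z
    by auto
  then show ?thesis
    by (subst conditional_mutual_information_eq[OF sd[OF Z] sd[OF sp[OF Y Z]] sd[OF sp[OF X Z]]
            sd[OF sp[OF X sp[OF Y Z]]]]) simp
qed

lemma prob_joint_mono:
  assumes X: "simple_function M X" and Y: "simple_function M Y" and Z: "simple_function M Z"
  shows "\<P>(t in M. X t = x \<and> Y t = y \<and> Z t = z) \<le> \<P>(t in M. X t = x \<and> Z t = z)"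
    and "\<P>(t in M. X t = x \<and> Y t = y \<and> Z t = z) \<le> \<P>(t in M. Y t = y \<and> Z t = z)"
    and "\<P>(t in M. X t = x \<and> Y t = y \<and> Z t = z) \<le> \<P>(t in M. Z t = z)"
proof -
  have [measurable]: "X \<in> measurable M (count_space UNIV)" "Y \<in> measurable M (count_space UNIV)"
    "Z \<in> measurable M (count_space UNIV)"
    using assms by (auto intro: measurable_simple_function)
  show "\<P>(t in M. X t = x \<and> Y t = y \<and> Z t = z) \<le> \<P>(t in M. X t = x \<and> Z t = z)"
    "\<P>(t in M. X t = x \<and> Y t = y \<and> Z t = z) \<le> \<P>(t in M. Y t = y \<and> Z t = z)"
    "\<P>(t in M. X t = x \<and> Y t = y \<and> Z t = z) \<le> \<P>(t in M. Z t = z)"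
    by (auto intro!: finite_measure_mono)
qed

text \<open>Turns the chain rule and monotonicity below into linear arithmetic on joint
  entropies.\<close>

lemma conditional_mutual_information_eq_entropy:
  assumes X: "simple_function M X" and Y: "simple_function M Y" and Z: "simple_function M Z"
  shows "\<I>(X ; Y | Z) =
    \<H>(\<lambda>t. (X t, Z t)) + \<H>(\<lambda>t. (Y t, Z t)) - \<H>(\<lambda>t. (X t, Y t, Z t)) - \<H>(Z)"
proof -
  let ?T = "\<lambda>t. (X t, Y t, Z t)"
  have T: "simple_function M ?T"
    by (intro simple_function_Pair X Y Z)
  let ?pxyz = "\<lambda>x y z. \<P>(t in M. X t = x \<and> Y t = y \<and> Z t = z)"
  let ?pxz = "\<lambda>x z. \<P>(t in M. X t = x \<and> Z t = z)"
  let ?pyz = "\<lambda>y z. \<P>(t in M. Y t = y \<and> Z t = z)"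
  let ?pz = "\<lambda>z. \<P>(t in M. Z t = z)"
  \<comment> \<open>A positive joint probability forces positive marginals, so the logarithm splits;
    otherwise both sides are zero.\<close>
  have "?pxyz x y z * log b (?pxyz x y z / (?pxz x z * (?pyz y z / ?pz z))) =
      ?pxyz x y z * log b (?pxyz x y z) + ?pxyz x y z * log b (?pz z)
      - ?pxyz x y z * log b (?pxz x z) - ?pxyz x y z * log b (?pyz y z)" for x y z
  proof (cases "?pxyz x y z = 0")
    case False
    then have "0 < ?pxyz x y z"
      by (simp add: zero_less_measure_iff)
    moreover from this have "0 < ?pxz x z" "0 < ?pyz y z" "0 < ?pz z"
      using prob_joint_mono[OF X Y Z, of x y z] by linarith+
    ultimately show ?thesis
      using b_gt_1 by (simp add: log_mult log_divide algebra_simps)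
  qed simp
  then have "\<I>(X ; Y | Z) = (\<Sum>(x, y, z)\<in>?T ` space M.
      ?pxyz x y z * log b (?pxyz x y z) + ?pxyz x y z * log b (?pz z)
      - ?pxyz x y z * log b (?pxz x z) - ?pxyz x y z * log b (?pyz y z))"
    by (simp only: conditional_mutual_information_eq_sum[OF X Y Z])
  moreover note
    entropy_simple_function_compose[OF T, of "\<lambda>(x, y, z). (x, z)"]
    entropy_simple_function_compose[OF T, of "\<lambda>(x, y, z). (y, z)"]
    entropy_simple_function_compose[OF T, of "\<lambda>t. t"]
    entropy_simple_function_compose[OF T, of "\<lambda>(x, y, z). z"]
  ultimately show ?thesis
    by (simp add: split_beta sum.distrib sum_subtractf prod_eq_iff)
qed

text \<open>Under the factorization the argument of the logarithm is 1 wherever the joint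
  probability is positive.\<close>

lemma conditional_mutual_information_eq_0:
  assumes X: "simple_function M X" and Y: "simple_function M Y" and Z: "simple_function M Z"
    and indep: "\<And>x y z. 0 < \<P>(t in M. Z t = z) \<Longrightarrow>
      \<P>(t in M. X t = x \<and> Y t = y \<bar> Z t = z) =
      \<P>(t in M. X t = x \<bar> Z t = z) * \<P>(t in M. Y t = y \<bar> Z t = z)"
  shows "\<I>(X ; Y | Z) = 0"
proof -
  let ?pxyz = "\<lambda>x y z. \<P>(t in M. X t = x \<and> Y t = y \<and> Z t = z)"
  have "?pxyz x y z * log b (?pxyz x y z /
      (\<P>(t in M. X t = x \<and> Z t = z) * (\<P>(t in M. Y t = y \<and> Z t = z) / \<P>(t in M. Z t = z)))) = 0"
    for x y z
  proof (cases "?pxyz x y z = 0")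
    case False
    then have "0 < ?pxyz x y z"
      by (simp add: zero_less_measure_iff)
    moreover from this have "0 < \<P>(t in M. X t = x \<and> Z t = z)"
      "0 < \<P>(t in M. Y t = y \<and> Z t = z)" "0 < \<P>(t in M. Z t = z)"
      using prob_joint_mono[OF X Y Z, of x y z] by linarith+
    ultimately show ?thesis
      using indep[of z x y] by (simp add: cond_prob_def field_simps)
  qed simp
  then show ?thesis
    unfolding conditional_mutual_information_eq_sum[OF X Y Z] by (auto intro!: sum.neutral)
qed

text \<open>
  In the next two lemmas \<open>D\<close> stands for the pair of \<open>A\<close> and \<open>B\<close>, and \<open>E\<close> for the pair of \<open>B\<close>
  and \<open>C\<close>, up to the order and nesting of the components.
\<close>

lemma conditional_mutual_information_chain:
  assumes Y: "simple_function M Y" and A: "simple_function M A" and B: "simple_function M B"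
    and C: "simple_function M C" and D: "simple_function M D" and E: "simple_function M E"
    and AB: "\<And>z z'. D z = D z' \<longleftrightarrow> A z = A z' \<and> B z = B z'"
    and BC: "\<And>z z'. E z = E z' \<longleftrightarrow> B z = B z' \<and> C z = C z'"
  shows "\<I>(Y ; D | C) = \<I>(Y ; B | C) + \<I>(Y ; A | E)"
proof -
  note sp = simple_function_Pair Y A B C D E
  have "\<H>(\<lambda>t. (D t, C t)) = \<H>(\<lambda>t. (A t, E t))" "\<H>(E) = \<H>(\<lambda>t. (B t, C t))"
    "\<H>(\<lambda>t. (Y t, D t, C t)) = \<H>(\<lambda>t. (Y t, A t, E t))"
    "\<H>(\<lambda>t. (Y t, B t, C t)) = \<H>(\<lambda>t. (Y t, E t))"
    by (rule entropy_cong; auto intro!: sp simp: AB BC)+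
  then show ?thesis
    by (simp add: conditional_mutual_information_eq_entropy sp)
qed

lemma conditional_mutual_information_mono:
  assumes Y: "simple_function M Y" and A: "simple_function M A" and B: "simple_function M B"
    and C: "simple_function M C" and E: "simple_function M E"
    and BC: "\<And>z z'. E z = E z' \<longleftrightarrow> B z = B z' \<and> C z = C z'"
    and indep: "\<I>(A ; B | C) = 0"
  shows "\<I>(Y ; A | C) \<le> \<I>(Y ; A | E)"
proof -
  note sp = simple_function_Pair Y A B C E
  have "\<H>(\<lambda>t. (A t, B t, C t)) = \<H>(\<lambda>t. (A t, E t))" "\<H>(\<lambda>t. (B t, C t)) = \<H>(E)"
    "\<H>(\<lambda>t. (A t, B t, Y t, C t)) = \<H>(\<lambda>t. (Y t, A t, E t))"
    "\<H>(\<lambda>t. (B t, Y t, C t)) = \<H>(\<lambda>t. (Y t, E t))"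
    "\<H>(\<lambda>t. (A t, Y t, C t)) = \<H>(\<lambda>t. (Y t, A t, C t))"
    by (rule entropy_cong; auto intro!: sp simp: BC)+
  \<comment> \<open>In terms of entropies, I(Y; A | E) - I(Y; A | C) = I(A; B | Y C) - I(A; B | C),
    and the last term is zero.\<close>
  moreover have "0 \<le> \<I>(A ; B | (\<lambda>t. (Y t, C t)))"
    by (intro conditional_mutual_information_nonneg sp)
  ultimately show ?thesis
    using indep by (simp add: conditional_mutual_information_eq_entropy sp)
qed

text \<open>Sums \<open>factor\<close> over \<open>u\<close>: the conditional probabilities of
  \<open>U\<close> add up to 1 and \<open>g\<close> does not depend on \<open>u\<close>. Serves to
  drop one variable from a product law.\<close>

lemma cond_prob_marginal:
  assumes U: "simple_function M U" and A: "{t \<in> space M. A t} \<in> events"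
    and C: "{t \<in> space M. C t} \<in> events" and pos: "0 < \<P>(t in M. C t)"
    and factor: "\<And>u. \<P>(t in M. A t \<and> U t = u \<bar> C t) = g * \<P>(t in M. U t = u \<bar> C t)"
  shows "\<P>(t in M. A t \<bar> C t) = g"
proof -
  have [measurable]: "U \<in> measurable M (count_space UNIV)" "Measurable.pred M A" "Measurable.pred M C"
    using assms by (auto intro: measurable_simple_function simp: pred_def)
  have fin: "finite (U ` space M)"
    using U by (rule simple_functionD)
  have total: "(\<Sum>u\<in>U ` space M. \<P>(t in M. B t \<and> U t = u \<and> C t)) = \<P>(t in M. B t \<and> C t)"
    if [measurable]: "Measurable.pred M B" for B
  proof -
    have "{t \<in> space M. B t \<and> C t} = (\<Union>u\<in>U ` space M. {t \<in> space M. B t \<and> U t = u \<and> C t})"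
      by auto
    then show ?thesis
      using fin by (subst finite_measure_finite_Union[symmetric]) (auto simp: disjoint_family_on_def)
  qed
  have "\<P>(t in M. A t \<and> C t) = (\<Sum>u\<in>U ` space M. g * \<P>(t in M. U t = u \<and> C t))"
    using factor pos by (subst total[symmetric]) (auto simp: cond_prob_def intro!: sum.cong)
  also have "\<dots> = g * \<P>(t in M. C t)"
    using total[of "\<lambda>_. True"] by (simp add: sum_distrib_left[symmetric])
  finally show ?thesis
    using pos by (simp add: cond_prob_def)
qed

end

section \<open>Splitting the primary rate\<close>

text \<open>The last two lines of assumptions are instances of nonnegativity, monotonicity and
  submodularity of the set function \<open>f\<close>.\<close>

lemma split_rate:
  fixes T R f1 f2 fw f12 fw1 fw2 fw12 :: real
  assumes "0 \<le> R" "T \<le> fw" "R \<le> f12" "T + R \<le> fw12"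
    and "0 \<le> f1" "0 \<le> f2" "fw \<le> fw1" "fw \<le> fw2"
    and "f12 \<le> f1 + f2" "fw12 \<le> fw1 + f2" "fw12 \<le> fw2 + f1" "fw12 + fw \<le> fw1 + fw2"
  obtains R1 R2 where "R = R1 + R2" "0 \<le> R1" "0 \<le> R2" "R1 \<le> f1" "R2 \<le> f2"
    "T + R1 \<le> fw1" "T + R2 \<le> fw2"
proof
  \<comment> \<open>The largest rate that the bounds on \<open>R1\<close> allow. If it is
    \<open>R\<close>, nothing is left over; if it is \<open>f1\<close> or \<open>fw1 - T\<close>,
    submodularity and the bounds on \<open>T\<close>, \<open>R\<close> and \<open>T + R\<close>
    control the remainder.\<close>
  let ?R1 = "min R (min f1 (fw1 - T))"
  show "R = ?R1 + (R - ?R1)" "0 \<le> ?R1" "0 \<le> R - ?R1" "?R1 \<le> f1" "R - ?R1 \<le> f2"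
    "T + ?R1 \<le> fw1" "T + (R - ?R1) \<le> fw2"
    using assms by (auto simp: min_def)
qed

section \<open>The rate region\<close>

theorem theorem2:
  fixes M :: "'m measure" and b :: real
    and \<omega> :: "('x1::finite, 'x2::finite, 'xs::finite, 'yp::finite, 'ys::finite) channel"
    and Z :: "('m, 'q, 'u, 'w, 'x1, 'x2, 'xs, 'yp, 'ys) rv_tuple"
  assumes "information_space M b"
    and "Z \<in> Pstar M \<omega>"
  shows "information_space.rate_region_o M b Z =
    {(Rs, Rp). 0 \<le> Rs \<and> 0 \<le> Rp \<and>
       Rp \<le> information_space.rho_p M b Z \<and>
       Rs \<le> information_space.rho_s M b Z \<and>
       Rs + Rp \<le> information_space.rho_sp M b Z}"
proof -
  interpret information_space M b by fact
  obtain Q U W X1 X2 Xs Yp Ys where Z: "Z = (Q, U, W, X1, X2, Xs, Yp, Ys)"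
    by (cases Z) (auto elim: prod_cases7)
  from assms(2) have
    sf: "simple_function M Q" "simple_function M U" "simple_function M W" "simple_function M X1"
      "simple_function M X2" "simple_function M Yp" "simple_function M Ys"
    and indep: "\<And>q x1 x2 u w.
      \<P>(z in M. X1 z = x1 \<and> X2 z = x2 \<and> U z = u \<and> W z = w \<bar> Q z = q) =
      \<P>(z in M. X1 z = x1 \<bar> Q z = q) * \<P>(z in M. X2 z = x2 \<bar> Q z = q) *
      \<P>(z in M. U z = u \<bar> Q z = q) * \<P>(z in M. W z = w \<bar> Q z = q)"
    unfolding Z Pstar_def by auto
  note sfs = sf simple_function_Pair
  have [measurable]: "Q \<in> measurable M (count_space UNIV)" "U \<in> measurable M (count_space UNIV)"
    "W \<in> measurable M (count_space UNIV)" "X1 \<in> measurable M (count_space UNIV)"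
    "X2 \<in> measurable M (count_space UNIV)"
    using sf by (auto intro: measurable_simple_function)

  \<comment> \<open>Marginals of the product law given \<open>Q\<close>\<close>
  have X1_X2_W: "\<P>(z in M. X1 z = x1 \<and> X2 z = x2 \<and> W z = w \<bar> Q z = q) =
      \<P>(z in M. X1 z = x1 \<bar> Q z = q) * \<P>(z in M. X2 z = x2 \<bar> Q z = q) * \<P>(z in M. W z = w \<bar> Q z = q)"
    if "0 < \<P>(z in M. Q z = q)" for x1 x2 w q
    using indep[of x1 x2 _ w q] that
    by - (rule cond_prob_marginal[OF sf(2)], simp, simp, simp_all add: conj_ac mult_ac)
  have X2_W: "\<P>(z in M. X2 z = x2 \<and> W z = w \<bar> Q z = q) =
      \<P>(z in M. X2 z = x2 \<bar> Q z = q) * \<P>(z in M. W z = w \<bar> Q z = q)"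
    if "0 < \<P>(z in M. Q z = q)" for x2 w q
    using X1_X2_W[of q _ x2 w] that
    by - (rule cond_prob_marginal[OF sf(4)], simp, simp, simp_all add: conj_ac mult_ac)
  have X1_W: "\<P>(z in M. X1 z = x1 \<and> W z = w \<bar> Q z = q) =
      \<P>(z in M. X1 z = x1 \<bar> Q z = q) * \<P>(z in M. W z = w \<bar> Q z = q)"
    if "0 < \<P>(z in M. Q z = q)" for x1 w q
    using X1_X2_W[of q x1 _ w] that
    by - (rule cond_prob_marginal[OF sf(5)], simp, simp, simp_all add: conj_ac mult_ac)
  have X2_U_W: "\<P>(z in M. X2 z = x2 \<and> U z = u \<and> W z = w \<bar> Q z = q) =
      \<P>(z in M. X2 z = x2 \<bar> Q z = q) * \<P>(z in M. U z = u \<bar> Q z = q) * \<P>(z in M. W z = w \<bar> Q z = q)"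
    if "0 < \<P>(z in M. Q z = q)" for x2 u w q
    using indep[of _ x2 u w q] that
    by - (rule cond_prob_marginal[OF sf(4)], simp, simp, simp_all add: conj_ac mult_ac)
  have U_W: "\<P>(z in M. U z = u \<and> W z = w \<bar> Q z = q) =
      \<P>(z in M. U z = u \<bar> Q z = q) * \<P>(z in M. W z = w \<bar> Q z = q)"
    if "0 < \<P>(z in M. Q z = q)" for u w q
    using X2_U_W[of q _ u w] that
    by - (rule cond_prob_marginal[OF sf(5)], simp, simp, simp_all add: conj_ac mult_ac)

  note eq_0 = conditional_mutual_information_eq_0
  note chain = conditional_mutual_information_chain
  note mono = conditional_mutual_information_mono
  note nonneg = conditional_mutual_information_nonneg

  \<comment> \<open>Vanishing conditional informations between the inputs\<close>
  have i_X2: "\<I>(X2 ; (\<lambda>z. (W z, X1 z)) | Q) = 0"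
    using X1_X2_W X1_W by (intro eq_0 sfs) (auto simp: conj_ac mult_ac)
  have i_X1: "\<I>(X1 ; (\<lambda>z. (W z, X2 z)) | Q) = 0"
    using X1_X2_W X2_W by (intro eq_0 sfs) (auto simp: conj_ac mult_ac)
  have i_WU: "\<I>(W ; U | Q) = 0"
    using U_W by (intro eq_0 sfs) (auto simp: conj_ac mult_ac)
  \<comment> \<open>The chain rule splits a zero information into two nonnegative terms, so both
    vanish.\<close>
  have "\<I>(X2 ; (\<lambda>z. (W z, X1 z)) | Q) = \<I>(X2 ; W | Q) + \<I>(X2 ; X1 | (\<lambda>z. (W z, Q z)))"
    by (rule chain) (auto intro!: sfs)
  moreover have "0 \<le> \<I>(X2 ; W | Q)" "0 \<le> \<I>(X2 ; X1 | (\<lambda>z. (W z, Q z)))"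
    by (intro nonneg sfs)+
  ultimately have i_X2_X1_W: "\<I>(X2 ; X1 | (\<lambda>z. (W z, Q z))) = 0"
    using i_X2 by linarith
  have "\<I>(X2 ; (\<lambda>z. (W z, X1 z)) | Q) = \<I>(X2 ; X1 | Q) + \<I>(X2 ; W | (\<lambda>z. (X1 z, Q z)))"
    by (rule chain) (auto intro!: sfs)
  moreover have "0 \<le> \<I>(X2 ; X1 | Q)" "0 \<le> \<I>(X2 ; W | (\<lambda>z. (X1 z, Q z)))"
    by (intro nonneg sfs)+
  ultimately have i_X2_X1: "\<I>(X2 ; X1 | Q) = 0"
    using i_X2 by linarith

  \<comment> \<open>Rate bounds of the two receivers\<close>
  define f1 where "f1 = \<I>(Yp ; X1 | (\<lambda>z. (W z, X2 z, Q z)))"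
  define f2 where "f2 = \<I>(Yp ; X2 | (\<lambda>z. (W z, X1 z, Q z)))"
  define fw where "fw = \<I>(Yp ; W | (\<lambda>z. (X1 z, X2 z, Q z)))"
  define f12 where "f12 = \<I>(Yp ; (\<lambda>z. (X1 z, X2 z)) | (\<lambda>z. (W z, Q z)))"
  define fw1 where "fw1 = \<I>(Yp ; (\<lambda>z. (W z, X1 z)) | (\<lambda>z. (X2 z, Q z)))"
  define fw2 where "fw2 = \<I>(Yp ; (\<lambda>z. (W z, X2 z)) | (\<lambda>z. (X1 z, Q z)))"
  define fw12 where "fw12 = \<I>(Yp ; (\<lambda>z. (W z, X1 z, X2 z)) | Q)"
  \<comment> \<open>The \<open>g\<close> bounds belong to the secondary receiver; \<open>hw\<close>
    and \<open>kw\<close> are \<open>gw\<close> and \<open>fw\<close> with the other inputs dropped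
    from the condition.\<close>
  define gu where "gu = \<I>(Ys ; U | (\<lambda>z. (W z, Q z)))"
  define gw where "gw = \<I>(Ys ; W | (\<lambda>z. (U z, Q z)))"
  define guw where "guw = \<I>(Ys ; (\<lambda>z. (U z, W z)) | Q)"
  define hw where "hw = \<I>(Ys ; W | Q)"
  define kw where "kw = \<I>(Yp ; W | Q)"
  note defs = f1_def f2_def fw_def f12_def fw1_def fw2_def fw12_def gu_def gw_def guw_def hw_def kw_def

  have pos: "0 \<le> f1" "0 \<le> f2" "0 \<le> fw" "0 \<le> gu" "0 \<le> hw" "0 \<le> kw"
    unfolding defs by (intro nonneg sfs)+
  have fw12: "fw12 = kw + f12"
    unfolding defs by (rule chain) (auto intro!: sfs)
  have guw: "guw = hw + gu"
    unfolding defs by (rule chain) (auto intro!: sfs)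
  \<comment> \<open>\<open>W\<close> and \<open>U\<close> are independent given \<open>Q\<close>, so
    conditioning on \<open>U\<close> cannot lower the information.\<close>
  have hw: "hw \<le> gw"
    unfolding defs by (rule mono[OF _ _ _ _ _ _ i_WU]) (auto intro!: sfs)

  \<comment> \<open>Submodularity and monotonicity of the primary bounds\<close>
  have "f12 = \<I>(Yp ; X2 | (\<lambda>z. (W z, Q z))) + f1"
    unfolding defs by (rule chain) (auto intro!: sfs)
  \<comment> \<open>\<open>X1\<close> is independent of \<open>X2\<close> given \<open>W\<close> and
    \<open>Q\<close>, so it may join the condition; \<open>sub2\<close> and \<open>sub3\<close>
    follow the same pattern.\<close>
  moreover have "\<I>(Yp ; X2 | (\<lambda>z. (W z, Q z))) \<le> f2"
    unfolding defs by (rule mono[OF _ _ _ _ _ _ i_X2_X1_W]) (auto intro!: sfs)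
  ultimately have sub1: "f12 \<le> f1 + f2"
    by linarith
  have fw12_fw1: "fw12 = \<I>(Yp ; X2 | Q) + fw1"
    unfolding defs by (rule chain) (auto intro!: sfs)
  moreover have "\<I>(Yp ; X2 | Q) \<le> f2"
    unfolding defs by (rule mono[OF _ _ _ _ _ _ i_X2]) (auto intro!: sfs)
  ultimately have sub2: "fw12 \<le> fw1 + f2"
    by linarith
  have "fw12 = \<I>(Yp ; X1 | Q) + fw2"
    unfolding defs by (rule chain) (auto intro!: sfs)
  moreover have "\<I>(Yp ; X1 | Q) \<le> f1"
    unfolding defs by (rule mono[OF _ _ _ _ _ _ i_X1]) (auto intro!: sfs)
  ultimately have sub3: "fw12 \<le> fw2 + f1"
    by linarith
  have fw2: "fw2 = \<I>(Yp ; X2 | (\<lambda>z. (X1 z, Q z))) + fw"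
    unfolding defs by (rule chain) (auto intro!: sfs)
  \<comment> \<open>By the chain rule the two sides are \<open>fw12 - fw1\<close> and
    \<open>fw2 - fw\<close>.\<close>
  moreover have "\<I>(Yp ; X2 | Q) \<le> \<I>(Yp ; X2 | (\<lambda>z. (X1 z, Q z)))"
    by (rule mono[OF _ _ _ _ _ _ i_X2_X1]) (auto intro!: sfs)
  ultimately have sub4: "fw12 + fw \<le> fw1 + fw2"
    using fw12_fw1 by linarith
  have "0 \<le> \<I>(Yp ; X2 | (\<lambda>z. (X1 z, Q z)))"
    by (intro nonneg sfs)
  with fw2 have fw_fw2: "fw \<le> fw2"
    by linarith
  have "fw1 = \<I>(Yp ; X1 | (\<lambda>z. (X2 z, Q z))) + fw"
    unfolding defs by (rule chain) (auto intro!: sfs)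
  moreover have "0 \<le> \<I>(Yp ; X1 | (\<lambda>z. (X2 z, Q z)))"
    by (intro nonneg sfs)
  ultimately have fw_fw1: "fw \<le> fw1"
    by linarith

  have delta: "(R1, R2, S, T) \<in> delta_o Z \<longleftrightarrow>
      0 \<le> R1 \<and> 0 \<le> R2 \<and> 0 \<le> S \<and> 0 \<le> T \<and> R1 \<le> f1 \<and> R2 \<le> f2 \<and> T \<le> fw \<and> R1 + R2 \<le> f12 \<and>
      T + R1 \<le> fw1 \<and> T + R2 \<le> fw2 \<and> T + R1 + R2 \<le> fw12 \<and> S \<le> gu \<and> T \<le> gw \<and> S + T \<le> guw"
    for R1 R2 S T
    unfolding Z defs by simp
  have rho: "rho_p Z = f12" "rho_s Z = gu + min fw hw" "rho_sp Z = f12 + gu + min hw kw"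
    unfolding Z defs by simp_all

  show ?thesis
  proof (intro equalityI subsetI)
    fix p assume "p \<in> rate_region_o Z"
    then obtain R1 R2 S T where "p = (S + T, R1 + R2)" "(R1, R2, S, T) \<in> delta_o Z"
      unfolding rate_region_o_def by blast
    \<comment> \<open>The bound on \<open>Rs + Rp\<close> arises in two ways:
      \<open>S \<le> gu\<close> with \<open>T + R1 + R2 \<le> fw12 = kw + f12\<close>, or
      \<open>S + T \<le> guw = hw + gu\<close> with \<open>R1 + R2 \<le> f12\<close>.\<close>
    then show "p \<in> {(Rs, Rp). 0 \<le> Rs \<and> 0 \<le> Rp \<and> Rp \<le> rho_p Z \<and> Rs \<le> rho_s Z \<and> Rs + Rp \<le> rho_sp Z}"
      unfolding delta rho using fw12 guw by auto
  next
    fix p assume "p \<in> {(Rs, Rp). 0 \<le> Rs \<and> 0 \<le> Rp \<and> Rp \<le> rho_p Z \<and> Rs \<le> rho_s Z \<and> Rs + Rp \<le> rho_sp Z}"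
    then obtain Rs Rp where p: "p = (Rs, Rp)" and Rs: "0 \<le> Rs" "Rs \<le> gu + min fw hw"
      and Rp: "0 \<le> Rp" "Rp \<le> f12" and sum: "Rs + Rp \<le> f12 + gu + min hw kw"
      unfolding rho by auto
    define S where "S = min Rs gu"
    define T where "T = Rs - S"
    \<comment> \<open>If \<open>Rs \<le> gu\<close>, then \<open>T = 0\<close> and
      \<open>Rp \<le> f12 \<le> fw12\<close>. Otherwise \<open>T = Rs - gu\<close>, and subtracting
      \<open>gu\<close> from the bounds on \<open>Rs\<close> and \<open>Rs + Rp\<close> gives the
      claims on \<open>T\<close>.\<close>
    have ST: "0 \<le> S" "0 \<le> T" "S \<le> gu" "Rs = S + T" "T \<le> fw" "T \<le> hw" "T + Rp \<le> fw12"
      using Rs Rp sum pos fw12 unfolding S_def T_def by (auto simp: min_def split: if_splits)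
    obtain R1 R2 where "Rp = R1 + R2" "0 \<le> R1" "0 \<le> R2" "R1 \<le> f1" "R2 \<le> f2"
      "T + R1 \<le> fw1" "T + R2 \<le> fw2"
      using split_rate[OF Rp(1) ST(5) Rp(2) ST(7) pos(1,2) fw_fw1 fw_fw2 sub1 sub2 sub3 sub4] by blast
    \<comment> \<open>The bounds at the secondary receiver follow from \<open>S \<le> gu\<close> and
      \<open>T \<le> hw\<close>, as \<open>hw \<le> gw\<close> and
      \<open>guw = hw + gu\<close>.\<close>
    with ST Rp hw guw have "(R1, R2, S, T) \<in> delta_o Z"
      unfolding delta by auto
    with \<open>Rp = R1 + R2\<close> ST show "p \<in> rate_region_o Z"
      unfolding p rate_region_o_def by blast
  qed
qed

end
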